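(* Let $\mathcal{B}$ be a finite-dimensional Banach space over $\mathbb{K}$, where $\mathbb{K}$ is either $\mathbb{R}$ or $\mathbb{C}$. Assume that $\Phi=(\varphi_\lambda)_{\lambda\in\Lambda}\subset\mathcal{B}'$ constitutes a frame for $\mathcal{B}$ with associated admissible Banach space $\mathfrak{B}\subset\mathbb{K}^\Lambda$, and that $\mathcal{A}_\Phi:\mathbb{P}_{\mathbb{K}}\mathcal{B}\to\mathfrak{B}$, $\mathcal{A}_\Phi(x)=|[x,\Phi]|$, is injective. Then $$\tau_{\Phi,\mathcal{B},\mathfrak{B}}<\infty.$$
   Context: Notation. $\mathcal{B}'$ is the topological dual of $\mathcal{B}$ with its norm, $[x,\psi]:=\psi(x)$, $[x,\Phi]:=([x,\varphi_\lambda])_{\lambda\in\Lambda}\in\mathbb{K}^\Lambda$ and $|[x,\Phi]|:=(|[x,\varphi_\lambda]|)_{\lambda\in\Lambda}$. For $S\subset\Lambda$, $\chi_S$ is the indicator function of $S$. $\mathbb{P}_{\mathbb{K}}\mathcal{B}$ is the quotient of $\mathcal{B}$ identifying $x$ with $\tau x$ for all $\tau\in\mathbb{K}$, $|\tau|=1$, with the distance $d_{\mathcal{B}}(x,y)=\min\{\|x-\tau y\|_{\mathcal{B}}:\tau\in\mathbb{K},|\tau|=1\}$. Admissible Banach space. Let $\Lambda$ be a $\sigma$-compact topological space. A Banach space $\mathfrak{B}\subset\mathbb{K}^\Lambda$ over $\mathbb{K}$ is admissible if (with the convention $\|w\|_{\mathfrak{B}}=\infty$ for $w\in\mathbb{K}^\Lambda\setminus\mathfrak{B}$):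 (i) $\|\chi_{\Lambda'}\|_{\mathfrak{B}}<\infty$ for every compact $\Lambda'\subset\Lambda$; (ii) $\mathfrak{B}$ is solid: $\|w\|_{\mathfrak{B}}=\||w|\|_{\mathfrak{B}}\le\|z\|_{\mathfrak{B}}$ for all $z\in\mathfrak{B}$ and $w$ with $|z(\lambda)|\ge|w(\lambda)|$ for all $\lambda\in\Lambda$; (iii) the elements of $\mathfrak{B}$ with compact support are dense in $\mathfrak{B}$. Frame. A family $\Phi=(\varphi_\lambda)_{\lambda\in\Lambda}\subset\mathcal{B}'$ with $\lambda\mapsto\varphi_\lambda$ continuous is a frame for $\mathcal{B}$ with associated admissible Banach space $\mathfrak{B}\subset\mathbb{K}^\Lambda$ if (B1) there are real constants $B\ge A>0$ with $A\|x\|_{\mathcal{B}}\le\|[x,\Phi]\|_{\mathfrak{B}}\le B\|x\|_{\mathcal{B}}$ for all $x\in\mathcal{B}$; and (B2) there is a continuous operator $R:\mathfrak{B}\to\mathcal{B}$ with $R([x,\Phi])=x$ for all $x\in\mathcal{B}$. Condition number. $\alpha_{\Phi,\mathcal{B},\mathfrak{B}}$ is the largest $\alpha\ge0$ and $\beta_{\Phi,\mathcal{B},\mathfrak{B}}$ the smallest $\beta$ such that $\alpha\, d_{\mathcal{B}}(x,y)\le\|\mathcal{A}_\Phi(x)-\mathcal{A}_\Phi(y)\|_{\mathfrak{B}}\le\beta\, d_{\mathcal{B}}(x,y)$ for all $x,y\in\mathcal{B}$; $\tau_{\Phi,\mathcal{B},\mathfrak{B}}:=\beta_{\Phi,\mathcal{B},\mathfrak{B}}/\alpha_{\Phi,\mathcal{B},\mathfrak{B}}$,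 understood as $\infty$ if $\alpha_{\Phi,\mathcal{B},\mathfrak{B}}=0$. *)

theory Defs
  imports "HOL-Analysis.Analysis" "HOL-Library.Function_Algebras"
begin

text \<open>
  The scalar field is a type \<open>'k::real_normed_field\<close>, which is only ever instantiated
  with \<^typ>\<open>real\<close> and \<^typ>\<open>complex\<close>. As the type classes only know real normed spaces, a normed
  space over \<open>'k\<close> is a real normed space together with a compatible scalar multiplication \<open>s\<close>.
\<close>

definition normed_space_over :: "('k::real_normed_field \<Rightarrow> 'b::real_normed_vector \<Rightarrow> 'b) \<Rightarrow> bool" where
  "normed_space_over s \<longleftrightarrow>
     vector_space s \<and>
     (\<forall>r x. s (of_real r) x = r *\<^sub>R x) \<and>
     (\<forall>c x. norm (s c x) = norm c * norm x)"

definition finite_dim_over :: "('k::real_normed_field \<Rightarrow> 'b::real_normed_vector \<Rightarrow> 'b) \<Rightarrow> bool" where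
  "finite_dim_over s \<longleftrightarrow> (\<exists>Basis. finite_dimensional_vector_space s Basis)"


subsection \<open>Admissible Banach spaces of functions\<close>

definition sigma_compact :: "'l::topological_space set \<Rightarrow> bool" where
  "sigma_compact S \<longleftrightarrow> (\<exists>C :: nat \<Rightarrow> 'l set. (\<forall>n. compact (C n)) \<and> (\<Union>n. C n) = S)"

text \<open>
  A normed space of functions is given by its carrier \<open>V\<close> and a norm \<open>N\<close>, whose values outside
  of \<open>V\<close> are irrelevant. \<open>ext_norm\<close> is the norm with the convention that it is infinite
  outside of \<open>V\<close>.
\<close>

definition ext_norm :: "('l \<Rightarrow> 'k) set \<Rightarrow> (('l \<Rightarrow> 'k) \<Rightarrow> real) \<Rightarrow> ('l \<Rightarrow> 'k) \<Rightarrow> ennreal" where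
  "ext_norm V N w = (if w \<in> V then ennreal (N w) else \<infinity>)"

text \<open>The locale \<^locale>\<open>Metric_space\<close> needs nonnegativity and symmetry outside of \<open>V\<close>, too.\<close>

definition fun_dist ::
  "('l \<Rightarrow> 'k::real_normed_field) set \<Rightarrow> (('l \<Rightarrow> 'k) \<Rightarrow> real) \<Rightarrow> ('l \<Rightarrow> 'k) \<Rightarrow> ('l \<Rightarrow> 'k) \<Rightarrow> real" where
  "fun_dist V N w z = (if w \<in> V \<and> z \<in> V then N (w - z) else 0)"

definition banach_function_space ::
  "('l \<Rightarrow> 'k::real_normed_field) set \<Rightarrow> (('l \<Rightarrow> 'k) \<Rightarrow> real) \<Rightarrow> bool" where
  "banach_function_space V N \<longleftrightarrow>
     module.subspace (\<lambda>c w l. c * w l) V \<and>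
     (\<forall>w\<in>V. 0 \<le> N w \<and> (N w = 0 \<longleftrightarrow> w = 0)) \<and>
     (\<forall>c. \<forall>w\<in>V. N (\<lambda>l. c * w l) = norm c * N w) \<and>
     (\<forall>w\<in>V. \<forall>z\<in>V. N (w + z) \<le> N w + N z) \<and>
     Metric_space.mcomplete V (fun_dist V N)"

definition modulus :: "('l \<Rightarrow> 'k::real_normed_field) \<Rightarrow> 'l \<Rightarrow> 'k" where
  "modulus w = (\<lambda>l. of_real (norm (w l)))"

definition admissible ::
  "('l::topological_space \<Rightarrow> 'k::real_normed_field) set \<Rightarrow> (('l \<Rightarrow> 'k) \<Rightarrow> real) \<Rightarrow> bool" where
  "admissible V N \<longleftrightarrow>
     sigma_compact (UNIV :: 'l set) \<and>
     banach_function_space V N \<and>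
     (\<forall>K. compact K \<longrightarrow> ext_norm V N (indicator K) < \<infinity>) \<and>
     (\<forall>z\<in>V. \<forall>w. (\<forall>l. norm (w l) \<le> norm (z l)) \<longrightarrow>
        ext_norm V N w = ext_norm V N (modulus w) \<and>
        ext_norm V N (modulus w) \<le> ext_norm V N z) \<and>
     Metric_space.mtopology V (fun_dist V N) closure_of
       {w \<in> V. compact (closure {l. w l \<noteq> 0})} = V"


subsection \<open>Frames\<close>

text \<open>
  The dual space consists of the \<open>'k\<close>-linear elements of \<open>'b \<Rightarrow>\<^sub>L 'k\<close>, the space of bounded
  real-linear maps; its operator norm restricts to the dual norm.
\<close>

definition coeffs :: "('l \<Rightarrow> 'b::real_normed_vector \<Rightarrow>\<^sub>L 'k::real_normed_field) \<Rightarrow> 'b \<Rightarrow> 'l \<Rightarrow> 'k" where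
  "coeffs \<Phi> x = (\<lambda>l. blinfun_apply (\<Phi> l) x)"

definition is_frame ::
  "('k::real_normed_field \<Rightarrow> 'b::banach \<Rightarrow> 'b) \<Rightarrow> ('l::topological_space \<Rightarrow> 'k) set \<Rightarrow>
   (('l \<Rightarrow> 'k) \<Rightarrow> real) \<Rightarrow> ('l \<Rightarrow> 'b \<Rightarrow>\<^sub>L 'k) \<Rightarrow> bool" where
  "is_frame s V N \<Phi> \<longleftrightarrow>
     admissible V N \<and>
     (\<forall>l. Vector_Spaces.linear s (*) (blinfun_apply (\<Phi> l))) \<and>
     continuous_on UNIV \<Phi> \<and>
     (\<exists>A B :: real. B \<ge> A \<and> A > 0 \<and>
        (\<forall>x. ennreal (A * norm x) \<le> ext_norm V N (coeffs \<Phi> x) \<and>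
             ext_norm V N (coeffs \<Phi> x) \<le> ennreal (B * norm x))) \<and>
     (\<exists>R :: ('l \<Rightarrow> 'k) \<Rightarrow> 'b.
        (\<forall>w\<in>V. \<forall>z\<in>V. R (w + z) = R w + R z) \<and>
        (\<forall>c. \<forall>w\<in>V. R (\<lambda>l. c * w l) = s c (R w)) \<and>
        continuous_map (Metric_space.mtopology V (fun_dist V N)) euclidean R \<and>
        (\<forall>x. R (coeffs \<Phi> x) = x))"


subsection \<open>Phase retrieval\<close>

definition phase_rel :: "('k::real_normed_field \<Rightarrow> 'b \<Rightarrow> 'b) \<Rightarrow> ('b \<times> 'b) set" where
  "phase_rel s = {(x, y). \<exists>\<tau>. norm \<tau> = 1 \<and> y = s \<tau> x}"

definition phase_quotient :: "('k::real_normed_field \<Rightarrow> 'b \<Rightarrow> 'b) \<Rightarrow> 'b set set" where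
  "phase_quotient s = UNIV // phase_rel s"

text \<open>For \<^typ>\<open>real\<close> and \<^typ>\<open>complex\<close> the scalars of modulus one are compact, so the infimum is
  a minimum.\<close>

definition phase_dist ::
  "('k::real_normed_field \<Rightarrow> 'b::real_normed_vector \<Rightarrow> 'b) \<Rightarrow> 'b \<Rightarrow> 'b \<Rightarrow> real" where
  "phase_dist s x y = (INF \<tau>\<in>{\<tau>. norm \<tau> = 1}. norm (x - s \<tau> y))"

definition phaseless ::
  "('l \<Rightarrow> 'b::real_normed_vector \<Rightarrow>\<^sub>L 'k::real_normed_field) \<Rightarrow> 'b \<Rightarrow> 'l \<Rightarrow> 'k" where
  "phaseless \<Phi> x = modulus (coeffs \<Phi> x)"

text \<open>\<^const>\<open>phaseless\<close> is constant on the equivalence classes, so it descends to the quotient.\<close>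

definition phaseless_quot ::
  "('l \<Rightarrow> 'b::real_normed_vector \<Rightarrow>\<^sub>L 'k::real_normed_field) \<Rightarrow> 'b set \<Rightarrow> 'l \<Rightarrow> 'k" where
  "phaseless_quot \<Phi> X = the_elem (phaseless \<Phi> ` X)"


subsection \<open>Condition number\<close>

text \<open>
  The largest lower and the smallest upper Lipschitz constant, as attained supremum and infimum
  in \<^typ>\<open>ennreal\<close>. For the zero space the former is \<open>\<infinity>\<close> and the latter is \<open>0\<close>.
\<close>

definition lower_lip ::
  "('k::real_normed_field \<Rightarrow> 'b::real_normed_vector \<Rightarrow> 'b) \<Rightarrow> ('l \<Rightarrow> 'k) set \<Rightarrow>
   (('l \<Rightarrow> 'k) \<Rightarrow> real) \<Rightarrow> ('l \<Rightarrow> 'b \<Rightarrow>\<^sub>L 'k) \<Rightarrow> ennreal" where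
  "lower_lip s V N \<Phi> = Sup {\<alpha>. \<forall>x y.
     \<alpha> * ennreal (phase_dist s x y) \<le> ext_norm V N (phaseless \<Phi> x - phaseless \<Phi> y)}"

definition upper_lip ::
  "('k::real_normed_field \<Rightarrow> 'b::real_normed_vector \<Rightarrow> 'b) \<Rightarrow> ('l \<Rightarrow> 'k) set \<Rightarrow>
   (('l \<Rightarrow> 'k) \<Rightarrow> real) \<Rightarrow> ('l \<Rightarrow> 'b \<Rightarrow>\<^sub>L 'k) \<Rightarrow> ennreal" where
  "upper_lip s V N \<Phi> = Inf {\<beta>. \<forall>x y.
     ext_norm V N (phaseless \<Phi> x - phaseless \<Phi> y) \<le> \<beta> * ennreal (phase_dist s x y)}"

text \<open>The case distinction is needed because \<open>0 / 0 = 0\<close> in \<^typ>\<open>ennreal\<close>.\<close>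

definition condition_number ::
  "('k::real_normed_field \<Rightarrow> 'b::real_normed_vector \<Rightarrow> 'b) \<Rightarrow> ('l \<Rightarrow> 'k) set \<Rightarrow>
   (('l \<Rightarrow> 'k) \<Rightarrow> real) \<Rightarrow> ('l \<Rightarrow> 'b \<Rightarrow>\<^sub>L 'k) \<Rightarrow> ennreal" where
  "condition_number s V N \<Phi> =
     (if lower_lip s V N \<Phi> = 0 then \<infinity> else upper_lip s V N \<Phi> / lower_lip s V N \<Phi>)"

end

theory Submission
  imports Defs
begin

text \<open>
  The upper Lipschitz constant is at most the upper frame bound: by solidity and the reverse
  triangle inequality, the distance of the phaseless measurements of \<open>x\<close> and \<open>y\<close> is at most the
  norm of the coefficients of \<open>x - \<tau> y\<close>, for every phase \<open>\<tau>\<close>. The point is the positivity of the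
  lower Lipschitz constant.

  View \<open>\<real>\<close> and \<open>\<complex>\<close> as real inner product spaces. Write \<open>a\<close> and \<open>b\<close> for the measurements of
  \<open>x\<close> and \<open>y\<close> at some index. Then \<open>\<bar>a\<bar>\<^sup>2 - \<bar>b\<bar>\<^sup>2 = (a + b) \<bullet> (a - b)\<close>,
  so phaseless measurements are compared through the inner products of the measurements of
  \<open>u = x + y\<close> and \<open>w = x - y\<close>. Vectors \<open>u\<close> and \<open>w\<close> for which all these inner products vanish are
  such that \<open>u + w\<close> and \<open>u - w\<close> have the same phaseless measurements, and injectivity then yields
  \<open>w = d u\<close> for a scalar \<open>d\<close> orthogonal to \<open>1\<close>, that is, a purely imaginary one
  (\<open>orthogonal_measurements_imp_imaginary_multiple\<close>).

  On the other hand, suppose that the phase of \<open>y\<close> is chosen such that \<open>\<parallel>x - y\<parallel>\<close> is minimal.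
  Comparing with the phases \<open>(1 + d) / (1 - d)\<close>, the Cayley transforms of imaginary scalars, one
  finds \<open>\<parallel>w\<parallel> \<le> \<parallel>w - d u\<parallel>\<close> for all imaginary \<open>d\<close> (\<open>aligned_imp_orthogonal\<close>). Unlike minimality itself,
  this condition is invariant under scaling \<open>u\<close> and \<open>w\<close> separately, so it survives when
  \<open>\<parallel>x - y\<parallel>\<close> tends to \<open>0\<close> and the difference is normalised. The pairs of unit vectors satisfying
  it form a compact set, because \<open>\<B>\<close> is finite-dimensional, and for each of them some inner product
  of measurements is nonzero. By compactness these inner products are uniformly nonzero. Finally,
  a lower bound for the difference of the phaseless measurements at one index is a lower bound for
  its norm, because point evaluations are bounded on an admissible space
  (\<open>admissible_point_evaluation\<close>).
\<close>

section \<open>Imaginary scalars and phases\<close>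

text \<open>
  The sort below treats \<^typ>\<open>real\<close> and \<^typ>\<open>complex\<close> uniformly: orthogonality to \<open>1\<close> says that
  a scalar is imaginary, without mention of conjugation. For \<^typ>\<open>real\<close> only \<open>0\<close> is imaginary.
\<close>

lemma norm_one_plus_eq_norm_one_minus_iff:
  fixes d :: "'k::{real_normed_field, euclidean_space}"
  shows "norm (1 + d) = norm (1 - d) \<longleftrightarrow> inner 1 d = 0"
proof -
  have "norm (1 + d) = norm (1 - d) \<longleftrightarrow> (norm (1 + d))\<^sup>2 = (norm (1 - d))\<^sup>2"
    by simp
  also have "\<dots> \<longleftrightarrow> inner 1 d = 0"
    by (simp add: power2_norm_eq_inner algebra_simps inner_commute)
  finally show ?thesis .
qed

lemma norm_one_minus_imaginary_ge_1:
  fixes d :: "'k::{real_normed_field, euclidean_space}"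
  assumes "inner 1 d = 0"
  shows "norm (1 - d) \<ge> 1"
proof -
  have "norm (1 + d) = norm (1 - d)"
    using assms by (simp add: norm_one_plus_eq_norm_one_minus_iff)
  moreover have "norm ((1 + d) + (1 - d)) \<le> norm (1 + d) + norm (1 - d)"
    by (rule norm_triangle_ineq)
  ultimately show ?thesis by simp
qed

lemma norm_diff_times_norm_sum:
  fixes a b :: "'a::real_inner"
  shows "\<bar>norm a - norm b\<bar> * (norm a + norm b) = \<bar>inner (a + b) (a - b)\<bar>"
proof -
  have "\<bar>norm a - norm b\<bar> * (norm a + norm b) = \<bar>(norm a - norm b) * (norm a + norm b)\<bar>"
    by (simp add: abs_mult)
  also have "(norm a - norm b) * (norm a + norm b) = (norm a)\<^sup>2 - (norm b)\<^sup>2"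
    by (simp add: power2_eq_square algebra_simps)
  also have "(norm a)\<^sup>2 - (norm b)\<^sup>2 = inner (a + b) (a - b)"
    by (simp add: power2_norm_eq_inner algebra_simps inner_commute)
  finally show ?thesis .
qed


section \<open>Finite-dimensional normed spaces\<close>

locale normed_space_over_field =
  fixes s :: "'k::{real_normed_field, euclidean_space} \<Rightarrow> 'b::real_normed_vector \<Rightarrow> 'b"
  assumes normed_space_over: "normed_space_over s"
begin

sublocale vector_space s
  using normed_space_over by (simp add: normed_space_over_def)

lemma norm_scale: "norm (s c x) = norm c * norm x"
  and scale_of_real: "s (of_real r) x = r *\<^sub>R x"
  using normed_space_over by (simp_all add: normed_space_over_def)

lemma scale_commute_scaleR: "s c (r *\<^sub>R x) = r *\<^sub>R s c x"
  by (metis scale_left_commute scale_of_real)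

lemma scaleR_scale: "s (r *\<^sub>R c) x = r *\<^sub>R s c x"
  by (simp add: scaleR_conv_of_real scale_of_real flip: scale_scale)

lemma bounded_linear_scale_left: "bounded_linear (\<lambda>c. s c x)"
  by (rule bounded_linear_intro[where K = "norm x"])
    (simp_all add: scale_left_distrib norm_scale scaleR_scale)

lemma bounded_linear_scale_right: "bounded_linear (s c)"
  by (rule bounded_linear_intro[where K = "norm c"])
    (simp_all add: scale_right_distrib norm_scale scale_commute_scaleR)

lemmas continuous_on_scale_left [continuous_intros] =
  bounded_linear.continuous_on[OF bounded_linear_scale_left]
lemmas continuous_on_scale_right [continuous_intros] =
  bounded_linear.continuous_on[OF bounded_linear_scale_right]

text \<open>A convergent sequence is bounded, so it stays within a single one of the compact parts.\<close>

lemma closed_if_compact_bounded_parts: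
  fixes S :: "'b set"
  assumes "\<And>M. compact (S \<inter> cball 0 M)"
  shows "closed S"
proof (rule closed_sequential_limits[THEN iffD2], intro allI impI, elim conjE)
  fix X l assume X: "\<forall>n. X n \<in> S" and lim: "X \<longlonglongrightarrow> l"
  from lim have "Bseq X" by (meson convergentI convergent_imp_Bseq)
  then obtain M where "\<forall>n. norm (X n) \<le> M" by (auto simp: Bseq_def)
  with X have "\<forall>n. X n \<in> S \<inter> cball 0 M" by simp
  moreover have "closed (S \<inter> cball 0 M)" by (rule compact_imp_closed[OF assms])
  ultimately have "l \<in> S \<inter> cball 0 M" using lim by (meson closed_sequentially)
  then show "l \<in> S" by simp
qed

text \<open>
  A vector \<open>b\<close> outside of the span of \<open>F\<close> has a positive distance from this span, as the span is
  closed by induction. This bounds the coefficient of \<open>b\<close> in a bounded vector, so that the bounded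
  part of the larger span lies in a sum of two compact sets.
\<close>

lemma compact_span_Int_cball:
  assumes "finite F"
  shows "compact (span F \<inter> cball 0 M)"
  using assms
proof (induction F arbitrary: M rule: finite_induct)
  case empty
  have "finite (span {} \<inter> cball 0 M)" by simp
  then show ?case by (rule finite_imp_compact)
next
  case (insert b F)
  show ?case
  proof (cases "b \<in> span F")
    case True
    then show ?thesis using insert.IH by (simp add: span_redundant)
  next
    case False
    have "closed (span F)" by (rule closed_if_compact_bounded_parts[OF insert.IH])
    then have "open (- span F)" by (simp add: open_Compl)
    with False obtain \<delta> where "\<delta> > 0" and ball: "ball b \<delta> \<subseteq> - span F"
      by (meson ComplI open_contains_ball)
    have coeff_bound: "norm c * \<delta> \<le> norm (s c b + y)" if "y \<in> span F" for c y
    proof (cases "c = 0")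
      case False
      have "s (- (1 / c)) y \<in> span F" using that by (rule span_scale)
      then have "s (- (1 / c)) y \<notin> ball b \<delta>" using ball by blast
      then have "\<delta> \<le> norm (b + s (1 / c) y)" by (simp add: dist_norm not_less)
      then have "norm c * \<delta> \<le> norm c * norm (b + s (1 / c) y)" by (simp add: mult_left_mono)
      also have "\<dots> = norm (s c b + y)"
        using False by (simp add: scale_right_distrib flip: norm_scale)
      finally show ?thesis .
    qed simp
    define P where "P = (\<lambda>c. s c b) ` cball 0 (M / \<delta>)"
    define Q where "Q = span F \<inter> cball 0 (M + M / \<delta> * norm b)"
    have "compact P"
      unfolding P_def by (intro compact_continuous_image continuous_intros compact_cball)
    moreover have "compact Q" unfolding Q_def by (rule insert.IH)
    ultimately have "compact {x + y | x y. x \<in> P \<and> y \<in> Q}" by (rule compact_sums)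
    then have "compact ({x + y | x y. x \<in> P \<and> y \<in> Q} \<inter> cball 0 M)"
      by (simp add: compact_Int_closed)
    also have "{x + y | x y. x \<in> P \<and> y \<in> Q} \<inter> cball 0 M = span (insert b F) \<inter> cball 0 M"
    proof (intro equalityI subsetI)
      fix z assume "z \<in> {x + y | x y. x \<in> P \<and> y \<in> Q} \<inter> cball 0 M"
      then obtain c y where z: "z = s c b + y" "y \<in> span F" "z \<in> cball 0 M"
        by (auto simp: P_def Q_def)
      have "z - s c b \<in> span F" using z by simp
      then show "z \<in> span (insert b F) \<inter> cball 0 M" using z(3) by (auto simp: span_insert)
    next
      fix z assume z: "z \<in> span (insert b F) \<inter> cball 0 M"
      then obtain c where c: "z - s c b \<in> span F" by (auto simp: span_insert)
      have "norm c * \<delta> \<le> norm z" using coeff_bound[OF c, of c] by simp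
      with z have "norm c * \<delta> \<le> M" by simp
      then have cM: "norm c \<le> M / \<delta>" using \<open>\<delta> > 0\<close> by (simp add: field_simps)
      have "norm (z - s c b) \<le> norm z + norm c * norm b"
        by (metis norm_triangle_ineq4 norm_scale)
      also have "\<dots> \<le> M + M / \<delta> * norm b"
        using z cM by (intro add_mono mult_right_mono) auto
      finally have "z - s c b \<in> Q" using c by (simp add: Q_def)
      moreover have "s c b \<in> P" unfolding P_def using cM by (intro imageI) simp
      moreover have "z = s c b + (z - s c b)" by simp
      ultimately show "z \<in> {x + y | x y. x \<in> P \<and> y \<in> Q} \<inter> cball 0 M" using z by blast
    qed
    finally show ?thesis .
  qed
qed

lemma compact_cball_if_finite_dim:
  assumes "finite_dim_over s"
  shows "compact (cball (0::'b) M)"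
proof -
  obtain Basis where "finite_dimensional_vector_space s Basis"
    using assms by (auto simp: finite_dim_over_def)
  then have "finite Basis" "span Basis = UNIV"
    by (auto simp: finite_dimensional_vector_space_def finite_dimensional_vector_space_axioms_def)
  then show ?thesis using compact_span_Int_cball[of Basis M] by simp
qed

lemma compact_sphere_if_finite_dim:
  assumes "finite_dim_over s"
  shows "compact (sphere (0::'b) M)"
proof -
  have "sphere (0::'b) M = cball 0 M \<inter> sphere 0 M" by auto
  moreover have "closed (sphere (0::'b) M)"
    unfolding sphere_def by (intro closed_Collect_eq continuous_intros)
  then have "compact (cball (0::'b) M \<inter> sphere 0 M)"
    by (intro compact_Int_closed compact_cball_if_finite_dim assms)
  ultimately show ?thesis by simp
qed


section \<open>Aligned vectors\<close>

lemma phase_dist_nonneg: "0 \<le> phase_dist s x y"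
  unfolding phase_dist_def by (rule cINF_greatest) (auto intro: exI[of _ 1])

lemma phase_dist_attained:
  obtains \<tau> where "norm \<tau> = 1" and "phase_dist s x y = norm (x - s \<tau> y)"
    and "\<And>\<sigma>. norm \<sigma> = 1 \<Longrightarrow> norm (x - s \<tau> y) \<le> norm (x - s \<sigma> y)"
proof -
  have "{\<tau>::'k. norm \<tau> = 1} = sphere 0 1" by auto
  then have "compact {\<tau>::'k. norm \<tau> = 1}" by simp
  moreover have "{\<tau>::'k. norm \<tau> = 1} \<noteq> {}" by (auto intro: exI[of _ 1])
  moreover have "continuous_on {\<tau>. norm \<tau> = 1} (\<lambda>\<tau>. norm (x - s \<tau> y))"
    by (intro continuous_intros)
  ultimately obtain \<tau> where \<tau>: "norm \<tau> = 1"
      "\<And>\<sigma>. norm \<sigma> = 1 \<Longrightarrow> norm (x - s \<tau> y) \<le> norm (x - s \<sigma> y)"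
    using continuous_attains_inf[of "{\<tau>. norm \<tau> = 1}" "\<lambda>\<tau>. norm (x - s \<tau> y)"] by auto
  then have "phase_dist s x y = norm (x - s \<tau> y)"
    unfolding phase_dist_def by (intro cInf_eq_minimum) auto
  with \<tau> show thesis by (intro that)
qed

text \<open>
  The Cayley transform \<open>\<tau> = (1 + d) / (1 - d)\<close> of an imaginary scalar is a phase with
  \<open>(1 - d) (x - \<tau> y) = (x - y) - d (x + y)\<close>. In the language of normed spaces, \<open>x - y\<close> is
  Birkhoff-James orthogonal to the imaginary multiples of \<open>x + y\<close>.
\<close>

lemma aligned_imp_orthogonal:
  assumes aligned: "\<And>\<tau>. norm \<tau> = 1 \<Longrightarrow> norm (x - y) \<le> norm (x - s \<tau> y)"
    and d: "inner 1 d = 0"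
  shows "norm (x - y) \<le> norm ((x - y) - s d (x + y))"
proof -
  define \<tau> where "\<tau> = (1 + d) / (1 - d)"
  have ge: "norm (1 - d) \<ge> 1" by (rule norm_one_minus_imaginary_ge_1[OF d])
  then have nz: "1 - d \<noteq> 0" by (metis norm_zero not_one_le_zero)
  have "norm (1 + d) = norm (1 - d)" using d by (simp add: norm_one_plus_eq_norm_one_minus_iff)
  then have "norm \<tau> = 1" using nz by (simp add: \<tau>_def norm_divide)
  have "norm (x - y) \<le> norm (1 - d) * norm (x - y)"
    using mult_right_mono[OF ge, of "norm (x - y)"] by simp
  also have "\<dots> \<le> norm (1 - d) * norm (x - s \<tau> y)"
    by (intro mult_left_mono aligned \<open>norm \<tau> = 1\<close>) simp
  also have "\<dots> = norm (s (1 - d) x - s (1 + d) y)"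
    using nz by (simp add: \<tau>_def scale_right_diff_distrib flip: norm_scale)
  also have "s (1 - d) x - s (1 + d) y = (x - y) - s d (x + y)"
    by (simp add: scale_left_diff_distrib scale_left_distrib scale_right_distrib)
  finally show ?thesis .
qed

text \<open>
  These pairs stand for the directions of \<open>x + y\<close> and \<open>x - y\<close> with \<open>x\<close> and \<open>y\<close> aligned. The
  condition is closed, so limits of such directions for \<open>\<parallel>x - y\<parallel> \<rightarrow> 0\<close> are included.
\<close>

definition orthogonal_unit_pairs :: "('b \<times> 'b) set" where
  "orthogonal_unit_pairs =
     {(u, w). norm u = 1 \<and> norm w = 1 \<and> (\<forall>d. inner 1 d = 0 \<longrightarrow> 1 \<le> norm (w - s d u))}"

lemma compact_orthogonal_unit_pairs:
  assumes "finite_dim_over s"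
  shows "compact orthogonal_unit_pairs"
proof -
  have "closed {p. 1 \<le> norm (snd p - s d (fst p))}" for d
    by (intro closed_Collect_le continuous_intros)
  then have "closed (\<Inter>d\<in>{d. inner 1 d = 0}. {p. 1 \<le> norm (snd p - s d (fst p))})"
    by blast
  moreover have "compact (sphere (0::'b) 1 \<times> sphere (0::'b) 1)"
    by (intro compact_Times compact_sphere_if_finite_dim assms)
  moreover have "orthogonal_unit_pairs = (sphere 0 1 \<times> sphere 0 1) \<inter>
      (\<Inter>d\<in>{d. inner 1 d = 0}. {p. 1 \<le> norm (snd p - s d (fst p))})"
    by (auto simp: orthogonal_unit_pairs_def)
  ultimately show ?thesis by (simp only: compact_Int_closed)
qed

lemma normalized_aligned_in_orthogonal_unit_pairs:
  assumes aligned: "\<And>\<tau>. norm \<tau> = 1 \<Longrightarrow> norm (x - y) \<le> norm (x - s \<tau> y)"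
    and "x + y \<noteq> 0" and "x - y \<noteq> 0"
  shows "((x + y) /\<^sub>R norm (x + y), (x - y) /\<^sub>R norm (x - y)) \<in> orthogonal_unit_pairs"
proof -
  have "1 \<le> norm ((x - y) /\<^sub>R norm (x - y) - s d ((x + y) /\<^sub>R norm (x + y)))"
    if d: "inner 1 d = 0" for d
  proof -
    \<comment> \<open>Normalising both vectors rescales \<open>d\<close> by a real factor, and it remains imaginary.\<close>
    define r where "r = norm (x - y) / norm (x + y)"
    have "inner 1 (r *\<^sub>R d) = 0" using d by simp
    from aligned_imp_orthogonal[OF aligned this]
    have "norm (x - y) \<le> norm ((x - y) - s (r *\<^sub>R d) (x + y))" .
    also have "(x - y) - s (r *\<^sub>R d) (x + y) =
        norm (x - y) *\<^sub>R ((x - y) /\<^sub>R norm (x - y) - s d ((x + y) /\<^sub>R norm (x + y)))"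
      using assms(3)
      by (simp add: scaleR_right_diff_distrib scale_commute_scaleR scaleR_scale r_def divide_inverse)
    also have "norm \<dots> =
        norm (x - y) * norm ((x - y) /\<^sub>R norm (x - y) - s d ((x + y) /\<^sub>R norm (x + y)))"
      by simp
    finally show ?thesis using assms(3) by simp
  qed
  then show ?thesis using assms(2,3) by (simp add: orthogonal_unit_pairs_def)
qed

end


section \<open>Phaseless measurements\<close>

lemma phaseless_eq_iff:
  "phaseless \<Phi> x = phaseless \<Phi> y \<longleftrightarrow> (\<forall>l. norm (\<Phi> l x) = norm (\<Phi> l y))"
  by (simp add: phaseless_def modulus_def coeffs_def fun_eq_iff)

lemma norm_phaseless_diff:
  "norm ((phaseless \<Phi> x - phaseless \<Phi> y) l) = \<bar>norm (\<Phi> l x) - norm (\<Phi> l y)\<bar>"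
  by (simp add: phaseless_def modulus_def coeffs_def flip: of_real_diff)

locale linear_measurements = normed_space_over_field s
  for s :: "'k::{real_normed_field, euclidean_space} \<Rightarrow> 'b::real_normed_vector \<Rightarrow> 'b" +
  fixes \<Phi> :: "'l::topological_space \<Rightarrow> 'b \<Rightarrow>\<^sub>L 'k"
  assumes linear: "Vector_Spaces.linear s (*) (blinfun_apply (\<Phi> l))"
begin

lemma measurement_scale: "\<Phi> l (s c x) = c * \<Phi> l x"
  using linear[of l] by (simp add: Vector_Spaces.linear_iff)

lemma phaseless_phase_invariant:
  assumes "norm \<tau> = 1"
  shows "phaseless \<Phi> (s \<tau> x) = phaseless \<Phi> x"
  using assms by (simp add: phaseless_eq_iff measurement_scale norm_mult)

lemma phaseless_quot_class: "phaseless_quot \<Phi> (phase_rel s `` {x}) = phaseless \<Phi> x"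
proof -
  have "x \<in> phase_rel s `` {x}" by (auto simp: phase_rel_def intro!: exI[of _ 1])
  then have "phaseless \<Phi> ` (phase_rel s `` {x}) = {phaseless \<Phi> x}"
    by (auto simp: phase_rel_def phaseless_phase_invariant)
  then show ?thesis by (simp add: phaseless_quot_def)
qed

lemma phaseless_injective:
  assumes inj: "inj_on (phaseless_quot \<Phi>) (phase_quotient s)"
    and "phaseless \<Phi> x = phaseless \<Phi> y"
  obtains \<tau> where "norm \<tau> = 1" and "y = s \<tau> x"
proof -
  have "phase_rel s `` {x} = phase_rel s `` {y}"
    using assms(2) by (intro inj_onD[OF inj])
      (simp_all add: phaseless_quot_class phase_quotient_def quotientI)
  moreover have "y \<in> phase_rel s `` {y}" by (auto simp: phase_rel_def intro!: exI[of _ 1])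
  ultimately have "(x, y) \<in> phase_rel s" by blast
  then show thesis using that by (auto simp: phase_rel_def)
qed

text \<open>
  Orthogonality of the measurements means that \<open>u + w\<close> and \<open>u - w\<close> have the same phaseless
  measurements, hence \<open>u - w = \<tau> (u + w)\<close>. Solving for \<open>w\<close> gives the inverse Cayley transform of
  a phase, which is imaginary.
\<close>

lemma orthogonal_measurements_imp_imaginary_multiple:
  assumes inj: "inj_on (phaseless_quot \<Phi>) (phase_quotient s)"
    and "u \<noteq> 0"
    and orth: "\<And>l. inner (\<Phi> l u) (\<Phi> l w) = 0"
  obtains d where "inner 1 d = 0" and "w = s d u"
proof -
  have "norm (\<Phi> l (u + w)) = norm (\<Phi> l (u - w))" for l
  proof -
    have "(norm (\<Phi> l (u + w)))\<^sup>2 = (norm (\<Phi> l (u - w)))\<^sup>2"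
      using orth[of l]
      by (simp add: power2_norm_eq_inner blinfun.add_right blinfun.diff_right
          inner_commute algebra_simps)
    then show ?thesis by simp
  qed
  then have "phaseless \<Phi> (u + w) = phaseless \<Phi> (u - w)" by (simp add: phaseless_eq_iff)
  with inj obtain \<tau> where \<tau>: "norm \<tau> = 1" and eq: "u - w = s \<tau> (u + w)"
    by (rule phaseless_injective)
  have nz: "1 + \<tau> \<noteq> 0"
  proof
    assume "1 + \<tau> = 0"
    then have "\<tau> = - 1" by (simp add: eq_neg_iff_add_eq_0 add.commute)
    have "2 *\<^sub>R u = (u - w) + (u + w)" by (simp add: scaleR_2)
    also have "\<dots> = 0" unfolding eq \<open>\<tau> = - 1\<close> by simp
    finally have "2 *\<^sub>R u = 0" .
    with \<open>u \<noteq> 0\<close> show False by simp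
  qed
  define d where "d = (1 - \<tau>) / (1 + \<tau>)"
  have "1 + d = 2 / (1 + \<tau>)" "1 - d = 2 * \<tau> / (1 + \<tau>)"
    using nz by (simp_all add: d_def field_simps)
  then have "norm (1 + d) = norm (1 - d)" using \<tau> by (simp add: norm_divide norm_mult)
  then have "inner 1 d = 0" by (simp add: norm_one_plus_eq_norm_one_minus_iff)
  moreover have "s (1 + \<tau>) w = s (1 - \<tau>) u"
    using eq by (simp add: scale_left_distrib scale_left_diff_distrib scale_right_distrib algebra_simps)
  then have "s (1 / (1 + \<tau>)) (s (1 + \<tau>) w) = s (1 / (1 + \<tau>)) (s (1 - \<tau>) u)" by simp
  then have "w = s d u" using nz by (simp add: d_def)
  ultimately show thesis by (rule that)
qed

lemma orthogonal_unit_pair_not_orthogonal_measurements: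
  assumes "inj_on (phaseless_quot \<Phi>) (phase_quotient s)"
    and "(u, w) \<in> orthogonal_unit_pairs"
  obtains l where "inner (\<Phi> l u) (\<Phi> l w) \<noteq> 0"
proof (rule ccontr)
  assume "\<not> thesis"
  then have orth: "\<And>l. inner (\<Phi> l u) (\<Phi> l w) = 0" using that by blast
  have "u \<noteq> 0" using assms(2) by (auto simp: orthogonal_unit_pairs_def)
  from orthogonal_measurements_imp_imaginary_multiple[OF assms(1) this orth]
  obtain d where "inner 1 d = 0" "w = s d u" by blast
  moreover from this(1) have "1 \<le> norm (w - s d u)"
    using assms(2) by (auto simp: orthogonal_unit_pairs_def)
  ultimately show False by simp
qed

text \<open>
  The quotient of \<open>(a + b) \<bullet> (a - b)\<close> by \<open>\<bar>a\<bar> + \<bar>b\<bar>\<close> is controlled since alignment with respect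
  to the phase \<open>-1\<close> makes \<open>x + y\<close> the larger one of \<open>x + y\<close> and \<open>x - y\<close>, so that
  \<open>\<parallel>x\<parallel> + \<parallel>y\<parallel> \<le> 2 \<parallel>x + y\<parallel>\<close>.
\<close>

lemma measurement_diff_lower_bound:
  assumes le: "norm (x - y) \<le> norm (x + y)" and nz: "x - y \<noteq> 0"
  shows "\<bar>inner (\<Phi> l ((x + y) /\<^sub>R norm (x + y))) (\<Phi> l ((x - y) /\<^sub>R norm (x - y)))\<bar> * norm (x - y)
    \<le> 2 * norm (\<Phi> l) * \<bar>norm (\<Phi> l x) - norm (\<Phi> l y)\<bar>"
    (is "\<bar>?i\<bar> * _ \<le> _")
proof -
  have pos: "norm (x - y) > 0" "norm (x + y) > 0"
    using le nz less_le_trans[of 0 "norm (x - y)" "norm (x + y)"] by simp_all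
  have "norm x + norm y \<le> 2 * norm (x + y)"
  proof -
    have "norm ((x + y) + (x - y)) \<le> norm (x + y) + norm (x - y)"
      "norm ((x + y) - (x - y)) \<le> norm (x + y) + norm (x - y)"
      by (rule norm_triangle_ineq norm_triangle_ineq4)+
    moreover have "(x + y) + (x - y) = 2 *\<^sub>R x" "(x + y) - (x - y) = 2 *\<^sub>R y"
      by (simp_all add: scaleR_2)
    ultimately show ?thesis using le by simp
  qed
  have "?i = inner (\<Phi> l (x + y)) (\<Phi> l (x - y)) / (norm (x + y) * norm (x - y))"
    by (simp add: blinfun.scaleR_right divide_inverse)
  then have "norm (x + y) * (\<bar>?i\<bar> * norm (x - y)) = \<bar>inner (\<Phi> l (x + y)) (\<Phi> l (x - y))\<bar>"
    using pos by (simp add: abs_divide abs_mult)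
  also have "\<dots> = \<bar>norm (\<Phi> l x) - norm (\<Phi> l y)\<bar> * (norm (\<Phi> l x) + norm (\<Phi> l y))"
    by (simp add: norm_diff_times_norm_sum blinfun.add_right blinfun.diff_right)
  also have "norm (\<Phi> l x) + norm (\<Phi> l y) \<le> norm (\<Phi> l) * (norm x + norm y)"
    using norm_blinfun[of "\<Phi> l" x] norm_blinfun[of "\<Phi> l" y] by (simp add: distrib_left)
  also have "norm (\<Phi> l) * (norm x + norm y) \<le> norm (\<Phi> l) * (2 * norm (x + y))"
    by (intro mult_left_mono) (fact, simp)
  finally have "norm (x + y) * (\<bar>?i\<bar> * norm (x - y))
      \<le> \<bar>norm (\<Phi> l x) - norm (\<Phi> l y)\<bar> * (norm (\<Phi> l) * (2 * norm (x + y)))"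
    by (simp only: mult_left_mono abs_ge_zero)
  also have "\<dots> = norm (x + y) * (2 * norm (\<Phi> l) * \<bar>norm (\<Phi> l x) - norm (\<Phi> l y)\<bar>)"
    by (simp only: mult_ac)
  finally show ?thesis using pos(2) by (simp only: mult_le_cancel_left_pos)
qed

end


section \<open>Admissible spaces\<close>

lemma admissible_mono:
  assumes "admissible V N" and "\<And>l. norm (w l) \<le> norm (z l)"
  shows "ext_norm V N w \<le> ext_norm V N z"
proof (cases "z \<in> V")
  case True
  have "\<forall>z\<in>V. \<forall>w. (\<forall>l. norm (w l) \<le> norm (z l)) \<longrightarrow>
      ext_norm V N w = ext_norm V N (modulus w) \<and> ext_norm V N (modulus w) \<le> ext_norm V N z"
    using assms(1) unfolding admissible_def by (elim conjE)
  from bspec[OF this True] have "ext_norm V N w = ext_norm V N (modulus w)"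
    and "ext_norm V N (modulus w) \<le> ext_norm V N z"
    using assms(2) by blast+
  then show ?thesis by (rule ord_eq_le_trans)
qed (simp add: ext_norm_def)

text \<open>Singletons are compact, so their indicators are nonzero elements of the space.\<close>

lemma admissible_point_evaluation:
  fixes V :: "('l::topological_space \<Rightarrow> 'k::real_normed_field) set"
  assumes "admissible V N"
  obtains c where "c > 0" and "\<And>w. ennreal (c * norm (w l)) \<le> ext_norm V N w"
proof
  define e :: "'l \<Rightarrow> 'k" where "e = indicator {l}"
  have bfs: "banach_function_space V N" and "ext_norm V N e < \<infinity>"
    using assms unfolding admissible_def e_def by simp_all
  then have e: "e \<in> V" by (auto simp: ext_norm_def split: if_splits)
  have "e l \<noteq> 0" by (simp add: e_def)
  then have "e \<noteq> 0" by auto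
  moreover have "0 \<le> N e \<and> (N e = 0 \<longleftrightarrow> e = 0)"
    using bfs e unfolding banach_function_space_def by simp
  ultimately show "N e > 0" by simp
  fix w
  show "ennreal (N e * norm (w l)) \<le> ext_norm V N w"
  proof (cases "w \<in> V")
    case True
    define v where "v = (\<lambda>m. w l * e m)"
    have "ext_norm V N v \<le> ext_norm V N w"
      by (rule admissible_mono[OF assms]) (simp add: v_def e_def indicator_def)
    moreover from this have "v \<in> V"
      using True by (auto simp: ext_norm_def top_unique split: if_splits)
    moreover have "N v = norm (w l) * N e"
      using bfs e unfolding v_def banach_function_space_def by simp
    ultimately show ?thesis by (simp add: ext_norm_def mult.commute)
  qed (simp add: ext_norm_def)
qed


section \<open>The Lipschitz constants\<close>

lemma compact_uniformly_positive:
  fixes h :: "'i \<Rightarrow> 'a::topological_space \<Rightarrow> real"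
  assumes "compact C" and cont: "\<And>i. continuous_on UNIV (h i)"
    and pos: "\<And>p. p \<in> C \<Longrightarrow> \<exists>i. h i p > 0"
  obtains \<alpha> where "\<alpha> > 0" and "\<And>p. p \<in> C \<Longrightarrow> \<exists>i. h i p \<ge> \<alpha>"
proof -
  define U where "U q = {p. h (fst q) p > inverse (real (Suc (snd q)))}" for q
  have "open (U q)" for q
    unfolding U_def by (intro open_Collect_less continuous_intros cont)
  moreover have "C \<subseteq> (\<Union>q\<in>UNIV. U q)"
  proof
    fix p assume "p \<in> C"
    then obtain i where "h i p > 0" using pos by blast
    then obtain n where "inverse (real (Suc n)) < h i p" using reals_Archimedean by blast
    then have "p \<in> U (i, n)" by (simp add: U_def)
    then show "p \<in> (\<Union>q\<in>UNIV. U q)" by blast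
  qed
  ultimately obtain D where D: "finite D" "C \<subseteq> (\<Union>q\<in>D. U q)"
    by (rule compactE_image[OF \<open>compact C\<close>])
  define m where "m = Max (snd ` D)"
  have "\<exists>i. h i p \<ge> inverse (real (Suc m))" if "p \<in> C" for p
  proof -
    from that D(2) obtain q where q: "q \<in> D" "h (fst q) p > inverse (real (Suc (snd q)))"
      by (auto simp: U_def)
    have "snd q \<le> m"
      unfolding m_def using D(1) q(1) by (intro Max_ge) auto
    then have "inverse (real (Suc m)) \<le> inverse (real (Suc (snd q)))"
      by (intro le_imp_inverse_le) auto
    with q(2) have "inverse (real (Suc m)) \<le> h (fst q) p" by linarith
    then show ?thesis ..
  qed
  then show thesis using that[of "inverse (real (Suc m))"] by simp
qed

text \<open>
  Given \<open>x\<close> and \<open>y\<close>, one replaces \<open>y\<close> by its best aligned multiple \<open>z\<close>, so that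
  \<open>x + z\<close> and \<open>x - z\<close> normalise to an orthogonal unit pair. At an index where this pair has
  measurements with an inner product bounded away from zero, the phaseless measurements of \<open>x\<close>
  and \<open>z\<close> differ by at least a multiple of \<open>\<parallel>x - z\<parallel>\<close>.
\<close>

lemma (in linear_measurements) lower_lip_positive:
  assumes fin: "finite_dim_over s" and adm: "admissible V N"
    and inj: "inj_on (phaseless_quot \<Phi>) (phase_quotient s)"
  shows "lower_lip s V N \<Phi> > 0"
proof -
  have "\<exists>c>0. \<forall>w. ennreal (c * norm (w l)) \<le> ext_norm V N w" for l
    using admissible_point_evaluation[OF adm, of l] by metis
  then obtain c where c: "\<And>l. c l > 0" "\<And>l w. ennreal (c l * norm (w l)) \<le> ext_norm V N w"
    by metis
  \<comment> \<open>The weights turn the inner products into lower bounds for the norm. If \<open>\<Phi> l = 0\<close>, then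
    \<open>h l\<close> vanishes, so that a positive value of \<open>h l\<close> excludes a division by zero.\<close>
  define h where "h l p = c l / (2 * norm (\<Phi> l)) * \<bar>inner (\<Phi> l (fst p)) (\<Phi> l (snd p))\<bar>"
    for l and p :: "'b \<times> 'b"
  have "continuous_on UNIV (h l)" for l
    unfolding h_def by (intro continuous_intros)
  moreover have "\<exists>l. h l p > 0" if p: "p \<in> orthogonal_unit_pairs" for p
  proof -
    obtain l where l: "inner (\<Phi> l (fst p)) (\<Phi> l (snd p)) \<noteq> 0"
      using orthogonal_unit_pair_not_orthogonal_measurements[OF inj, of "fst p" "snd p"] p by auto
    then have "\<Phi> l \<noteq> 0" by auto
    with l c(1)[of l] have "h l p > 0" by (simp add: h_def)
    then show ?thesis ..
  qed
  ultimately obtain \<alpha> where \<alpha>: "\<alpha> > 0" "\<And>p. p \<in> orthogonal_unit_pairs \<Longrightarrow> \<exists>l. h l p \<ge> \<alpha>"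
    using compact_uniformly_positive[OF compact_orthogonal_unit_pairs[OF fin], of h] by metis
  have "ennreal \<alpha> * ennreal (phase_dist s x y) \<le> ext_norm V N (phaseless \<Phi> x - phaseless \<Phi> y)"
    for x y
  proof -
    obtain \<tau> where \<tau>: "norm \<tau> = 1" "phase_dist s x y = norm (x - s \<tau> y)"
        "\<And>\<sigma>. norm \<sigma> = 1 \<Longrightarrow> norm (x - s \<tau> y) \<le> norm (x - s \<sigma> y)"
      using phase_dist_attained[of x y] by blast
    define z where "z = s \<tau> y"
    have aligned: "norm (x - z) \<le> norm (x - s \<sigma> z)" if "norm \<sigma> = 1" for \<sigma>
      using \<tau>(3)[of "\<sigma> * \<tau>"] \<tau>(1) that by (simp add: z_def norm_mult)
    have le: "norm (x - z) \<le> norm (x + z)" using aligned[of "- 1"] by simp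
    show ?thesis
    proof (cases "x - z = 0")
      case True
      then show ?thesis using \<tau>(2) by (simp add: z_def)
    next
      case False
      with le have "x + z \<noteq> 0" by auto
      define p where "p = ((x + z) /\<^sub>R norm (x + z), (x - z) /\<^sub>R norm (x - z))"
      have "p \<in> orthogonal_unit_pairs"
        unfolding p_def using aligned \<open>x + z \<noteq> 0\<close> False
        by (rule normalized_aligned_in_orthogonal_unit_pairs)
      then obtain l where l: "h l p \<ge> \<alpha>" using \<alpha>(2) by blast
      with \<alpha>(1) have "\<Phi> l \<noteq> 0" by (auto simp: h_def)
      have "\<alpha> * phase_dist s x y \<le> h l p * norm (x - z)"
        using l \<tau>(2) by (simp add: z_def mult_right_mono)
      also have "\<dots> = c l / (2 * norm (\<Phi> l)) *
          (\<bar>inner (\<Phi> l (fst p)) (\<Phi> l (snd p))\<bar> * norm (x - z))"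
        by (simp add: h_def)
      also have "\<dots> \<le> c l / (2 * norm (\<Phi> l)) *
          (2 * norm (\<Phi> l) * \<bar>norm (\<Phi> l x) - norm (\<Phi> l z)\<bar>)"
        using measurement_diff_lower_bound[OF le False, of l] c(1)[of l]
        by (intro mult_left_mono) (simp_all add: p_def)
      also have "\<dots> = c l * norm ((phaseless \<Phi> x - phaseless \<Phi> z) l)"
        using \<open>\<Phi> l \<noteq> 0\<close> by (simp only: norm_phaseless_diff) simp
      finally have "ennreal (\<alpha> * phase_dist s x y) \<le> ext_norm V N (phaseless \<Phi> x - phaseless \<Phi> z)"
        using c(2) by (meson ennreal_leI order_trans)
      moreover have "phaseless \<Phi> z = phaseless \<Phi> y"
        using \<tau>(1) by (simp add: z_def phaseless_phase_invariant)
      ultimately show ?thesis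
        using \<alpha>(1) phase_dist_nonneg[of x y] by (simp add: ennreal_mult)
    qed
  qed
  then have "ennreal \<alpha> \<le> lower_lip s V N \<Phi>"
    unfolding lower_lip_def by (intro Sup_upper) simp
  with \<alpha>(1) show ?thesis by (meson ennreal_less_zero_iff less_le_trans)
qed

lemma (in linear_measurements) upper_lip_le:
  assumes adm: "admissible V N" and "B \<ge> 0"
    and B: "\<And>x. ext_norm V N (coeffs \<Phi> x) \<le> ennreal (B * norm x)"
  shows "upper_lip s V N \<Phi> \<le> ennreal B"
proof -
  have "ext_norm V N (phaseless \<Phi> x - phaseless \<Phi> y) \<le> ennreal B * ennreal (phase_dist s x y)"
    for x y
  proof -
    obtain \<tau> where \<tau>: "norm \<tau> = 1" "phase_dist s x y = norm (x - s \<tau> y)"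
      using phase_dist_attained[of x y] by blast
    have "norm ((phaseless \<Phi> x - phaseless \<Phi> y) l) \<le> norm (coeffs \<Phi> (x - s \<tau> y) l)" for l
    proof -
      have "norm ((phaseless \<Phi> x - phaseless \<Phi> y) l) = \<bar>norm (\<Phi> l x) - norm (\<Phi> l (s \<tau> y))\<bar>"
        using \<tau>(1) by (simp only: norm_phaseless_diff measurement_scale norm_mult mult_1)
      also have "\<dots> \<le> norm (\<Phi> l x - \<Phi> l (s \<tau> y))" by (rule norm_triangle_ineq3)
      finally show ?thesis by (simp add: coeffs_def blinfun.diff_right)
    qed
    then have "ext_norm V N (phaseless \<Phi> x - phaseless \<Phi> y)
        \<le> ext_norm V N (coeffs \<Phi> (x - s \<tau> y))"
      by (rule admissible_mono[OF adm])
    also have "\<dots> \<le> ennreal (B * norm (x - s \<tau> y))" by (rule B)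
    finally show ?thesis using \<tau>(2) \<open>B \<ge> 0\<close> by (simp add: ennreal_mult)
  qed
  then show ?thesis unfolding upper_lip_def by (intro Inf_lower) simp
qed

lemma condition_number_finite:
  fixes s :: "'k::{real_normed_field, euclidean_space} \<Rightarrow> 'b::banach \<Rightarrow> 'b"
    and V :: "('l::topological_space \<Rightarrow> 'k) set"
  assumes "normed_space_over s" and "finite_dim_over s" and frame: "is_frame s V N \<Phi>"
    and "inj_on (phaseless_quot \<Phi>) (phase_quotient s)"
  shows "condition_number s V N \<Phi> < \<infinity>"
proof -
  interpret linear_measurements s \<Phi>
    using assms(1) frame
    by (intro linear_measurements.intro normed_space_over_field.intro
        linear_measurements_axioms.intro) (simp_all add: is_frame_def)
  have adm: "admissible V N" using frame by (simp add: is_frame_def)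
  obtain A B where "A > 0" "B \<ge> A"
      and B: "\<And>x. ext_norm V N (coeffs \<Phi> x) \<le> ennreal (B * norm x)"
    using frame unfolding is_frame_def by blast
  then have "upper_lip s V N \<Phi> \<le> ennreal B" by (intro upper_lip_le adm) auto
  then have "upper_lip s V N \<Phi> < \<infinity>" by (simp add: le_less_trans)
  moreover have "lower_lip s V N \<Phi> > 0" by (rule lower_lip_positive[OF assms(2) adm assms(4)])
  ultimately have "upper_lip s V N \<Phi> / lower_lip s V N \<Phi> \<noteq> \<infinity>"
    by (auto simp: ennreal_divide_eq_top_iff)
  with \<open>lower_lip s V N \<Phi> > 0\<close> show ?thesis by (simp add: condition_number_def less_top)
qed

theorem theorem3p11:
  shows "(\<forall>(s :: real \<Rightarrow> 'b::banach \<Rightarrow> 'b)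
            (V :: ('l::topological_space \<Rightarrow> real) set) N (\<Phi> :: 'l \<Rightarrow> 'b \<Rightarrow>\<^sub>L real).
            normed_space_over s \<longrightarrow> finite_dim_over s \<longrightarrow>
            is_frame s V N \<Phi> \<longrightarrow>
            inj_on (phaseless_quot \<Phi>) (phase_quotient s) \<longrightarrow>
            condition_number s V N \<Phi> < \<infinity>) \<and>
         (\<forall>(s :: complex \<Rightarrow> 'b \<Rightarrow> 'b)
            (V :: ('l \<Rightarrow> complex) set) N (\<Phi> :: 'l \<Rightarrow> 'b \<Rightarrow>\<^sub>L complex).
            normed_space_over s \<longrightarrow> finite_dim_over s \<longrightarrow>
            is_frame s V N \<Phi> \<longrightarrow>
            inj_on (phaseless_quot \<Phi>) (phase_quotient s) \<longrightarrow>
            condition_number s V N \<Phi> < \<infinity>)"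
  by (blast intro: condition_number_finite)

end
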